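(* Let $A$ be a nonempty finite set of positive integers and let $n,d,e\in\mathbb{N}$. Let $f_A^{I},f_A^{II}$ be the functions defined in the context. 1. If $d\ge f_A^{I}(n)$ and $e<f_A^{II}(n)$, then $W_A^{\rm cash}(n;d,e)=\mathrm{I}$. 2. If $d<f_A^{I}(n)$ and $e\ge f_A^{II}(n)$, then $W_A^{\rm cash}(n;d,e)=\mathrm{II}$. 3. If $d\ge f_A^{I}(n)$ and $e\ge f_A^{II}(n)$, then $W_A^{\rm cash}(n;d,e)=W_A(n)$.
   Context: $\mathbb{N}=\{0,1,2,\dots\}$. Let $A$ be a nonempty finite set of positive integers and $a_1=\min(A)$. NIM: there are $n$ stones on the board. Players I and II alternate, Player I first; on his turn a player removes $a$ stones for some $a\in A$ not exceeding the number of stones present. A player who cannot move (fewer than $a_1$ stones) loses. $W_A(n)\in\{\mathrm{I},\mathrm{II}\}$ is the player with a winning strategy. NIM with cash, state $(n;d,e)$: $n$ stones are on the board, Player I (who moves first) has $d$ dollars and Player II has $e$ dollars. Players alternate. A player removing $a\in A$ stones also loses $a$ dollars, so $a$ may exceed neither the number of stones nor the mover's dollars. A player who cannot move (fewer than $a_1$ stones, or he has fewer than $a_1$ dollars) loses. $W_A^{\rm cash}(n;d,e)\in\{\mathrm{I},\mathrm{II}\}$ is the player with a winning strategy. Equivalently, $W_A^{\rm cash}(n;d,e)=\mathrm{I}$ iff there is $a\in A$ with $a\le n$, $a\le d$ and $W_A^{\rm cash}(n-a;e,d-a)=\mathrm{II}$. The functions $f_A^{I},f_A^{II}:\mathbb{N}\to\mathbb{N}$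 are defined by simultaneous recursion on $n$ (below, $a$ ranges over elements of $A$ with $a\le n$): - If $0\le n\le a_1-1$: $f_A^{I}(n)=f_A^{II}(n)=0$. - If $n\ge a_1$: $f_A^{II}(n)=\max_a f_A^{I}(n-a)$. - If $n\ge a_1$ and $W_A(n)=\mathrm{I}$: $f_A^{I}(n)=\min\{f_A^{II}(n-a)+a : W_A(n-a)=\mathrm{II}\}$. - If $n\ge a_1$ and $W_A(n)=\mathrm{II}$: $f_A^{I}(n)=\min\{f_A^{II}(n-a)+a : f_A^{I}(n-a)=f_A^{II}(n)\}$. *)

theory Defs
  imports Main
begin

section \<open>Two-player games in which a player who cannot move loses\<close>

datatype player = PlayerI | PlayerII

text \<open>A position is a pair of the player to move and a configuration, and
  \<open>move p q\<close> says that the player to move at \<open>p\<close> may move to \<open>q\<close>.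
  Since the position includes the player to move, a strategy is a function on positions.\<close>

type_synonym 's position = "player \<times> 's"

definition legal_strategy ::
  "('s position \<Rightarrow> 's position \<Rightarrow> bool) \<Rightarrow> player \<Rightarrow> ('s position \<Rightarrow> 's position) \<Rightarrow> bool" where
  "legal_strategy move P \<sigma> \<longleftrightarrow>
     (\<forall>p. fst p = P \<longrightarrow> (\<exists>q. move p q) \<longrightarrow> move p (\<sigma> p))"

definition consistent_play ::
  "('s position \<Rightarrow> 's position \<Rightarrow> bool) \<Rightarrow> player \<Rightarrow> ('s position \<Rightarrow> 's position)
     \<Rightarrow> 's position \<Rightarrow> 's position list \<Rightarrow> bool" where
  "consistent_play move P \<sigma> p ps \<longleftrightarrow>
     ps \<noteq> [] \<and> hd ps = p \<and>
     successively (\<lambda>q r. move q r \<and> (fst q = P \<longrightarrow> r = \<sigma> q)) ps"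

definition completed_play ::
  "('s position \<Rightarrow> 's position \<Rightarrow> bool) \<Rightarrow> 's position list \<Rightarrow> bool" where
  "completed_play move ps \<longleftrightarrow> (\<nexists>q. move (last ps) q)"

text \<open>Only finite plays are considered: the games below have no infinite plays, as every
  move strictly decreases the number of stones.\<close>

definition winning_strategy ::
  "('s position \<Rightarrow> 's position \<Rightarrow> bool) \<Rightarrow> player \<Rightarrow> ('s position \<Rightarrow> 's position)
     \<Rightarrow> 's position \<Rightarrow> bool" where
  "winning_strategy move P \<sigma> p \<longleftrightarrow>
     legal_strategy move P \<sigma> \<and>
     (\<forall>ps. consistent_play move P \<sigma> p ps \<and> completed_play move ps \<longrightarrow> fst (last ps) \<noteq> P)"

definition winner ::
  "('s position \<Rightarrow> 's position \<Rightarrow> bool) \<Rightarrow> 's position \<Rightarrow> player" where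
  "winner move p = (THE P. \<exists>\<sigma>. winning_strategy move P \<sigma> p)"


section \<open>NIM and NIM with cash\<close>

inductive nim_move :: "nat set \<Rightarrow> nat position \<Rightarrow> nat position \<Rightarrow> bool" for A :: "nat set" where
  "a \<in> A \<Longrightarrow> a \<le> n \<Longrightarrow> nim_move A (PlayerI, n) (PlayerII, n - a)"
| "a \<in> A \<Longrightarrow> a \<le> n \<Longrightarrow> nim_move A (PlayerII, n) (PlayerI, n - a)"

definition W :: "nat set \<Rightarrow> nat \<Rightarrow> player" where
  "W A n = winner (nim_move A) (PlayerI, n)"

text \<open>In a configuration \<open>(n, d, e)\<close> there are \<open>n\<close> stones, and Player I has \<open>d\<close> and
  Player II has \<open>e\<close> dollars, whoever is to move.\<close>

inductive cash_move ::
  "nat set \<Rightarrow> (nat \<times> nat \<times> nat) position \<Rightarrow> (nat \<times> nat \<times> nat) position \<Rightarrow> bool"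
  for A :: "nat set" where
  "a \<in> A \<Longrightarrow> a \<le> n \<Longrightarrow> a \<le> d \<Longrightarrow>
     cash_move A (PlayerI, n, d, e) (PlayerII, n - a, d - a, e)"
| "a \<in> A \<Longrightarrow> a \<le> n \<Longrightarrow> a \<le> e \<Longrightarrow>
     cash_move A (PlayerII, n, d, e) (PlayerI, n - a, d, e - a)"

definition W_cash :: "nat set \<Rightarrow> nat \<Rightarrow> nat \<Rightarrow> nat \<Rightarrow> player" where
  "W_cash A n d e = winner (cash_move A) (PlayerI, n, d, e)"


section \<open>The functions \<open>f_I\<close> and \<open>f_II\<close>\<close>

text \<open>The condition \<open>0 < a\<close> only makes the recursion terminate for every \<open>A\<close>; it is redundant
  for sets of positive integers.  For nonempty finite such sets, the extrema below are taken
  over nonempty finite sets: see \<open>f_I_extrema_nonempty\<close>.\<close>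

definition takes :: "nat set \<Rightarrow> nat \<Rightarrow> nat set" where
  "takes A n = {a \<in> A. 0 < a \<and> a \<le> n}"

lemma takes_eq: "0 \<notin> A \<Longrightarrow> takes A n = {a \<in> A. a \<le> n}"
  by (auto simp: takes_def intro: gr0I)

lemma takes_cong [fundef_cong]:
  "(\<And>a. a \<in> takes A n \<Longrightarrow> P a = Q a) \<Longrightarrow> {a \<in> takes A n. P a} = {a \<in> takes A n. Q a}"
  by blast

function f_I :: "nat set \<Rightarrow> nat \<Rightarrow> nat" and f_II :: "nat set \<Rightarrow> nat \<Rightarrow> nat" where
  "f_I A n =
     (if n < Min A then 0
      else if W A n = PlayerI
        then (MIN a \<in> {a \<in> takes A n. W A (n - a) = PlayerII}. f_II A (n - a) + a)
        else (MIN a \<in> {a \<in> takes A n. f_I A (n - a) = f_II A n}. f_II A (n - a) + a))"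
| "f_II A n =
     (if n < Min A then 0 else (MAX a \<in> takes A n. f_I A (n - a)))"
  by pat_completeness auto
termination
  by (relation "measure (case_sum (\<lambda>(A, n). 2 * n + 1) (\<lambda>(A, n). 2 * n))")
    (auto simp: takes_def)

declare f_I.simps [simp del] f_II.simps [simp del]


section \<open>Well-definedness\<close>

text \<open>When there are no infinite plays, exactly one player has a winning strategy.\<close>

definition other :: "player \<Rightarrow> player" where
  "other P = (case P of PlayerI \<Rightarrow> PlayerII | PlayerII \<Rightarrow> PlayerI)"

lemma other_iff: "Q \<noteq> P \<longleftrightarrow> Q = other P"
  by (cases P; cases Q) (auto simp: other_def)

inductive wins :: "('s position \<Rightarrow> 's position \<Rightarrow> bool) \<Rightarrow> player \<Rightarrow> 's position \<Rightarrow> bool"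
  for move P where
  own: "fst p = P \<Longrightarrow> move p q \<Longrightarrow> wins move P q \<Longrightarrow> wins move P p"
| opp: "fst p \<noteq> P \<Longrightarrow> (\<And>q. move p q \<Longrightarrow> wins move P q) \<Longrightarrow> wins move P p"

lemma wins_imp_strategy:
  assumes "wins move P p"
  shows "\<exists>\<sigma>. winning_strategy move P \<sigma> p"
proof -
  define \<sigma> where "\<sigma> = (\<lambda>q. if \<exists>r. move q r \<and> wins move P r
    then SOME r. move q r \<and> wins move P r else SOME r. move q r)"
  have 1: "move q (\<sigma> q) \<and> wins move P (\<sigma> q)" if "move q r" "wins move P r" for q r
  proof -
    have ex: "\<exists>r. move q r \<and> wins move P r"
      using that by blast
    show ?thesis
      using someI_ex[OF ex] unfolding \<sigma>_def if_P[OF ex] .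
  qed
  have legal: "legal_strategy move P \<sigma>"
    unfolding legal_strategy_def
  proof (intro allI impI, elim exE)
    fix q r assume "move q r"
    then show "move q (\<sigma> q)"
    proof (cases "\<exists>r. move q r \<and> wins move P r")
      case True
      then show ?thesis using 1 by blast
    next
      case False
      show ?thesis
        using \<open>move q r\<close> unfolding \<sigma>_def if_not_P[OF False] by (rule someI)
    qed
  qed
  have step: "wins move P r" if "wins move P q" "move q r" "fst q = P \<longrightarrow> r = \<sigma> q" for q r
    using that(1)
  proof cases
    case (own s)
    then show ?thesis using 1[of q s] that by auto
  next
    case opp
    then show ?thesis using that by auto
  qed
  have inv: "wins move P (last ps)"
    if "ps \<noteq> []" "wins move P (hd ps)"
      "successively (\<lambda>q r. move q r \<and> (fst q = P \<longrightarrow> r = \<sigma> q)) ps" for ps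
    using that
  proof (induction ps)
    case (Cons q ps)
    then show ?case
      using step by (cases ps) auto
  qed simp
  have stuck: "fst q \<noteq> P" if "wins move P q" "\<nexists>r. move q r" for q
    using that by cases auto
  show ?thesis
    using legal inv stuck assms
    unfolding winning_strategy_def consistent_play_def completed_play_def by blast
qed

lemma wins_determined:
  assumes "wfP (\<lambda>q p. move p q)"
  shows "wins move P p \<or> wins move (other P) p"
  using assms
proof (induction p rule: wfp_induct_rule)
  case (less p)
  show ?case
  proof (cases "fst p = P")
    case True
    then have "fst p \<noteq> other P"
      using other_iff by blast
    with True less show ?thesis
      by (blast intro: wins.intros)
  next
    case False
    then have "fst p = other P"
      using other_iff by blast
    with False less show ?thesis
      by (blast intro: wins.intros)
  qed
qed

lemma common_play:
  assumes "wfP (\<lambda>q p. move p q)"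
    and "legal_strategy move P \<sigma>" and "legal_strategy move (other P) \<tau>"
  shows "\<exists>ps. consistent_play move P \<sigma> p ps \<and> consistent_play move (other P) \<tau> p ps
    \<and> completed_play move ps"
  using assms(1)
proof (induction p rule: wfp_induct_rule)
  case (less p)
  show ?case
  proof (cases "\<exists>q. move p q")
    case False
    then show ?thesis
      by (intro exI[of _ "[p]"]) (auto simp: consistent_play_def completed_play_def)
  next
    case True
    define q where "q = (if fst p = P then \<sigma> p else \<tau> p)"
    have q: "move p q"
    proof (cases "fst p = P")
      case own: True
      then show ?thesis
        using True assms(2) unfolding q_def legal_strategy_def if_P[OF own] by blast
    next
      case opp: False
      then have "fst p = other P"
        using other_iff by blast
      then show ?thesis
        using True assms(3) unfolding q_def legal_strategy_def if_not_P[OF opp] by blast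
    qed
    obtain ps where "consistent_play move P \<sigma> q ps" "consistent_play move (other P) \<tau> q ps"
      "completed_play move ps"
      using less[OF q] by blast
    moreover have "fst p = P \<longrightarrow> q = \<sigma> p" "fst p = other P \<longrightarrow> q = \<tau> p"
      using other_iff[of "fst p" P] unfolding q_def by auto
    ultimately have "consistent_play move P \<sigma> p (p # ps)"
      "consistent_play move (other P) \<tau> p (p # ps)" "completed_play move (p # ps)"
      using q by (simp_all add: consistent_play_def completed_play_def successively_Cons)
    then show ?thesis by blast
  qed
qed

lemma winning_strategy_unique:
  assumes "wfP (\<lambda>q p. move p q)" "winning_strategy move P \<sigma> p"
  shows "\<not> winning_strategy move (other P) \<tau> p"
proof
  assume \<tau>: "winning_strategy move (other P) \<tau> p"
  then obtain ps where "consistent_play move P \<sigma> p ps" "consistent_play move (other P) \<tau> p ps"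
    "completed_play move ps"
    using common_play[OF assms(1), of P \<sigma> \<tau> p] assms(2)
    unfolding winning_strategy_def by blast
  then have "fst (last ps) \<noteq> P" "fst (last ps) \<noteq> other P"
    using assms(2) \<tau> unfolding winning_strategy_def by blast+
  then show False
    using other_iff by blast
qed

theorem ex1_winner:
  assumes "wfP (\<lambda>q p. move p q)"
  shows "\<exists>!P. \<exists>\<sigma>. winning_strategy move P \<sigma> p"
proof -
  obtain P \<sigma> where P: "winning_strategy move P \<sigma> p"
    using wins_determined[OF assms, of PlayerI p] wins_imp_strategy by blast
  have "Q = P" if "winning_strategy move Q \<tau> p" for Q \<tau>
    using winning_strategy_unique[OF assms P] that other_iff[of Q P] by blast
  with P show ?thesis by blast
qed

lemma winner_eq_iff:
  assumes "wfP (\<lambda>q p. move p q)"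
  shows "winner move p = P \<longleftrightarrow> (\<exists>\<sigma>. winning_strategy move P \<sigma> p)"
  using theI'[OF ex1_winner[OF assms, of p]] ex1_winner[OF assms, of p]
  unfolding winner_def by blast

lemma winner_eq_wins:
  assumes "wfP (\<lambda>q p. move p q)"
  shows "winner move p = P \<longleftrightarrow> wins move P p"
  using winner_eq_iff[OF assms, of p P] wins_imp_strategy[of move P p]
    wins_imp_strategy[of move "other P" p] wins_determined[OF assms, of P p]
    winning_strategy_unique[OF assms, of P _ p] by blast

lemma winner_rec:
  assumes "wfP (\<lambda>q p. move p q)"
  shows "winner move p = fst p \<longleftrightarrow> (\<exists>q. move p q \<and> winner move q = fst p)"
  unfolding winner_eq_wins[OF assms] by (subst wins.simps) auto

lemma wf_nim_move:
  assumes "0 \<notin> A"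
  shows "wfP (\<lambda>q p. nim_move A p q)"
proof (rule wfp_if_convertible_to_nat)
  show "snd q < snd p" if "nim_move A p q" for p q
    using that assms by cases (auto intro!: diff_less gr0I)
qed

lemma wf_cash_move:
  assumes "0 \<notin> A"
  shows "wfP (\<lambda>q p. cash_move A p q)"
proof (rule wfp_if_convertible_to_nat)
  show "fst (snd q) < fst (snd p)" if "cash_move A p q" for p q
    using that assms by cases (auto intro!: diff_less gr0I)
qed

text \<open>By the symmetry between the players, the winners satisfy the usual recursions.\<close>

lemma other_other [simp]: "other (other P) = P"
  by (cases P) (simp_all add: other_def)

lemma other_neq_iff: "other P \<noteq> other Q \<longleftrightarrow> P \<noteq> Q"
  by (metis other_other)

lemma wins_swap:
  assumes "wins move P p"
    and "\<And>p. swap (swap p) = p" "\<And>p. fst (swap p) = other (fst p)"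
    and "\<And>p q. move p q \<Longrightarrow> move (swap p) (swap q)"
  shows "wins move (other P) (swap p)"
  using assms(1)
proof (induction rule: wins.induct)
  case (own p q)
  show ?case
    by (rule wins.own[where q = "swap q"]) (use own assms(3,4) in auto)
next
  case (opp p)
  show ?case
  proof (rule wins.opp)
    show "fst (swap p) \<noteq> other P"
      using opp(1) unfolding assms(3) other_neq_iff .
    fix q assume "move (swap p) q"
    then have "move p (swap q)"
      using assms(4)[of "swap p" q] by (simp only: assms(2))
    from opp(3)[OF this] show "wins move (other P) q"
      by (simp only: assms(2))
  qed
qed

lemma wins_nim_swap:
  "wins (nim_move A) P p \<Longrightarrow> wins (nim_move A) (other P) (other (fst p), snd p)"
  by (rule wins_swap[where swap = "\<lambda>p. (other (fst p), snd p)"])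
    (auto elim!: nim_move.cases intro: nim_move.intros simp: other_def split: player.splits)

lemma wins_cash_swap:
  "wins (cash_move A) P p \<Longrightarrow>
     wins (cash_move A) (other P) (case p of (Q, n, d, e) \<Rightarrow> (other Q, n, e, d))"
  by (rule wins_swap[where swap = "\<lambda>p. case p of (Q, n, d, e) \<Rightarrow> (other Q, n, e, d)"])
    (auto elim!: cash_move.cases intro: cash_move.intros simp: other_def split: player.splits)

theorem W_rec:
  assumes "0 \<notin> A"
  shows "W A n = PlayerI \<longleftrightarrow> (\<exists>a\<in>A. a \<le> n \<and> W A (n - a) = PlayerII)"
proof -
  have swap: "winner (nim_move A) (PlayerII, m) = PlayerI \<longleftrightarrow> W A m = PlayerII" for m
    using wins_nim_swap[of A PlayerI "(PlayerII, m)"] wins_nim_swap[of A PlayerII "(PlayerI, m)"]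
    unfolding W_def winner_eq_wins[OF wf_nim_move[OF assms]] by (auto simp: other_def)
  have "W A n = PlayerI \<longleftrightarrow>
      (\<exists>q. nim_move A (PlayerI, n) q \<and> winner (nim_move A) q = PlayerI)"
    using winner_rec[OF wf_nim_move[OF assms], of "(PlayerI, n)"] unfolding W_def by simp
  also have "\<dots> \<longleftrightarrow> (\<exists>a\<in>A. a \<le> n \<and> winner (nim_move A) (PlayerII, n - a) = PlayerI)"
    by (subst nim_move.simps) auto
  finally show ?thesis unfolding swap .
qed

theorem W_cash_rec:
  assumes "0 \<notin> A"
  shows "W_cash A n d e = PlayerI \<longleftrightarrow>
    (\<exists>a\<in>A. a \<le> n \<and> a \<le> d \<and> W_cash A (n - a) e (d - a) = PlayerII)"
proof -
  have swap: "winner (cash_move A) (PlayerII, m, x, y) = PlayerI \<longleftrightarrow> W_cash A m y x = PlayerII"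
    for m x y
    using wins_cash_swap[of A PlayerI "(PlayerII, m, x, y)"]
      wins_cash_swap[of A PlayerII "(PlayerI, m, y, x)"]
    unfolding W_cash_def winner_eq_wins[OF wf_cash_move[OF assms]] by (auto simp: other_def)
  have "W_cash A n d e = PlayerI \<longleftrightarrow>
      (\<exists>q. cash_move A (PlayerI, n, d, e) q \<and> winner (cash_move A) q = PlayerI)"
    using winner_rec[OF wf_cash_move[OF assms], of "(PlayerI, n, d, e)"]
    unfolding W_cash_def by simp
  also have "\<dots> \<longleftrightarrow> (\<exists>a\<in>A. a \<le> n \<and> a \<le> d \<and>
      winner (cash_move A) (PlayerII, n - a, d - a, e) = PlayerI)"
    by (subst cash_move.simps) auto
  finally show ?thesis unfolding swap .
qed

lemma f_I_extrema_nonempty: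
  assumes "finite A" "A \<noteq> {}" "0 \<notin> A" "Min A \<le> n"
  shows "finite (takes A n)" "takes A n \<noteq> {}"
    and "W A n = PlayerI \<Longrightarrow> {a \<in> takes A n. W A (n - a) = PlayerII} \<noteq> {}"
    and "{a \<in> takes A n. f_I A (n - a) = f_II A n} \<noteq> {}"
proof -
  show fin: "finite (takes A n)"
    by (simp add: takes_def)
  show ne: "takes A n \<noteq> {}"
    using Min_in[OF assms(1,2)] assms(3,4) by (auto simp: takes_eq)
  show "{a \<in> takes A n. W A (n - a) = PlayerII} \<noteq> {}" if "W A n = PlayerI"
    using that W_rec[OF assms(3), of n] assms(3) by (auto simp: takes_eq)
  have "f_II A n = (MAX a \<in> takes A n. f_I A (n - a))"
    using assms(4) by (simp add: f_II.simps)
  then have "f_II A n \<in> (\<lambda>a. f_I A (n - a)) ` takes A n"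
    using fin ne by simp
  then show "{a \<in> takes A n. f_I A (n - a) = f_II A n} \<noteq> {}"
    by auto
qed

end

theory Submission
  imports Defs
begin

text \<open>Call the player to move rich if he has at least \<open>f_I n\<close> dollars, his opponent rich if he
  has at least \<open>f_II n\<close>, and either of them poor otherwise.  The claim is that a rich player beats
  a poor one, and that between two rich players cash does not matter.  It follows by strong
  induction on the number of stones, for all \<open>d\<close> and \<open>e\<close> at once, since a move to
  \<open>(n - a; e, d - a)\<close> exchanges the roles of the two amounts.

  The mover wins in two ways.  If NIM is a win, he plays the winning \<open>a\<close> that minimises
  \<open>f_II (n - a) + a\<close>.  Having \<open>f_I n\<close> dollars, he keeps \<open>f_II (n - a)\<close> and is rich again,
  so the opponent loses either for lack of cash or because NIM from \<open>n - a\<close> is lost.  If NIM is a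
  loss but the opponent has less than \<open>f_II n\<close>, the mover plays, among the \<open>a\<close> that attain the
  maximum defining \<open>f_II n\<close>, one that minimises \<open>f_II (n - a) + a\<close>.  He is rich again, and the
  opponent, who now needs \<open>f_I (n - a) = f_II n\<close>, is poor.

  Conversely, suppose that the opponent has at least \<open>f_II n\<close>.  As \<open>f_II n\<close> is a maximum over
  all moves, he is rich at every \<open>n - a\<close>.  So he wins there if NIM from \<open>n - a\<close> is a win for him,
  and also if the mover is left with less than \<open>f_II (n - a)\<close>.  When NIM is a loss for the mover,
  the first holds after every move; when \<open>d < f_I n\<close>, the second holds after each winning NIM
  move, because \<open>f_I n\<close> is a minimum over those.\<close>

lemma f_I_le_f_II:
  assumes "a \<in> takes A n" "Min A \<le> n"
  shows "f_I A (n - a) \<le> f_II A n"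
proof -
  have "finite (takes A n)"
    by (simp add: takes_def)
  then show ?thesis
    using assms by (simp add: f_II.simps[of A n])
qed

lemma f_I_le_winning:
  assumes "W A n = PlayerI" "a \<in> takes A n" "W A (n - a) = PlayerII" "Min A \<le> n"
  shows "f_I A n \<le> f_II A (n - a) + a"
proof -
  have "finite (takes A n)"
    by (simp add: takes_def)
  then show ?thesis
    using assms by (auto simp: f_I.simps[of A n] intro!: Min_le)
qed

lemma f_I_attained_winning:
  assumes "finite A" "A \<noteq> {}" "0 \<notin> A" "Min A \<le> n" "W A n = PlayerI"
  obtains a where "a \<in> takes A n" "W A (n - a) = PlayerII" "f_I A n = f_II A (n - a) + a"
proof -
  let ?S = "{a \<in> takes A n. W A (n - a) = PlayerII}"
  have "Min ((\<lambda>a. f_II A (n - a) + a) ` ?S) \<in> (\<lambda>a. f_II A (n - a) + a) ` ?S"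
    using f_I_extrema_nonempty[OF assms(1-4)] assms(5) by (intro Min_in) auto
  moreover have "f_I A n = Min ((\<lambda>a. f_II A (n - a) + a) ` ?S)"
    using assms(4,5) by (simp add: f_I.simps[of A n])
  ultimately show ?thesis
    using that by auto
qed

lemma f_I_attained_losing:
  assumes "finite A" "A \<noteq> {}" "0 \<notin> A" "Min A \<le> n" "W A n = PlayerII"
  obtains a where "a \<in> takes A n" "f_I A (n - a) = f_II A n" "f_I A n = f_II A (n - a) + a"
proof -
  let ?S = "{a \<in> takes A n. f_I A (n - a) = f_II A n}"
  have "Min ((\<lambda>a. f_II A (n - a) + a) ` ?S) \<in> (\<lambda>a. f_II A (n - a) + a) ` ?S"
    using f_I_extrema_nonempty[OF assms(1-4)] by (intro Min_in) auto
  moreover have "f_I A n = Min ((\<lambda>a. f_II A (n - a) + a) ` ?S)"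
    using assms(4,5) by (simp add: f_I.simps[of A n])
  ultimately show ?thesis
    using that by auto
qed

theorem theorem2p4:
  fixes A :: "nat set" and n d e :: nat
  assumes "finite A" and "A \<noteq> {}" and "\<And>a. a \<in> A \<Longrightarrow> 0 < a"
  shows "(d \<ge> f_I A n \<and> e < f_II A n \<longrightarrow> W_cash A n d e = PlayerI) \<and>
         (d < f_I A n \<and> e \<ge> f_II A n \<longrightarrow> W_cash A n d e = PlayerII) \<and>
         (d \<ge> f_I A n \<and> e \<ge> f_II A n \<longrightarrow> W_cash A n d e = W A n)"
proof (induction n arbitrary: d e rule: less_induct)
  case (less n)
  have pos: "0 \<notin> A"
    using assms(3) by blast
  have II: "P = PlayerII \<longleftrightarrow> P \<noteq> PlayerI" for P
    by (cases P) auto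
  note rec = W_cash_rec[OF pos, of n]
  show ?case
  proof (cases "n < Min A")
    case True
    then have no_move: "\<not> a \<le> n" if "a \<in> A" for a
      using that Min_le[OF assms(1) that] by linarith
    have "W A n = PlayerII" "W_cash A n d e = PlayerII"
      using no_move W_rec[OF pos, of n] rec[of d e] by (auto simp: II)
    with True show ?thesis
      by (simp add: f_I.simps[of A n] f_II.simps[of A n])
  next
    case False
    then have n: "Min A \<le> n" by simp
    have IH: "e < f_I A (n - a) \<Longrightarrow> f_II A (n - a) \<le> c \<Longrightarrow> W_cash A (n - a) e c = PlayerII"
      "f_I A (n - a) \<le> e \<Longrightarrow> c < f_II A (n - a) \<Longrightarrow> W_cash A (n - a) e c = PlayerI"
      "f_I A (n - a) \<le> e \<Longrightarrow> f_II A (n - a) \<le> c \<Longrightarrow> W_cash A (n - a) e c = W A (n - a)"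
      if "a \<in> takes A n" for a c
      using less[of "n - a" e c] that by (auto simp: takes_def)
    \<comment> \<open>The price \<open>f_II (n - a) + a\<close> leaves the mover rich at \<open>n - a\<close>, so there the opponent loses
      if he is poor or if NIM is lost for the player to move.\<close>
    have move: "W_cash A n d e = PlayerI"
      if "a \<in> takes A n" "f_I A n = f_II A (n - a) + a" "f_I A n \<le> d"
        and "e < f_I A (n - a) \<or> W A (n - a) = PlayerII" for a
    proof -
      have "f_II A (n - a) \<le> d - a" "a \<le> d"
        using that(2,3) by linarith+
      then have "W_cash A (n - a) e (d - a) = PlayerII"
        using IH(1,3)[OF that(1), of "d - a"] that(4) by (cases "e < f_I A (n - a)") auto
      then show ?thesis
        using rec[of d e] that(1) \<open>a \<le> d\<close> by (auto simp: takes_def)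
    qed
    have win: "W_cash A n d e = PlayerI" if "W A n = PlayerI" "f_I A n \<le> d"
      using f_I_attained_winning[OF assms(1,2) pos n that(1)] move that(2) by metis
    have exhaust: "W_cash A n d e = PlayerI"
      if "W A n = PlayerII" "f_I A n \<le> d" "e < f_II A n"
      using f_I_attained_losing[OF assms(1,2) pos n that(1)] move that(2,3) by metis
    \<comment> \<open>A rich opponent stays rich after every move; NIM from \<open>n - a\<close> can only be lost for him if
      NIM from \<open>n\<close> is won, and then the mover is poor both at \<open>n\<close> and at \<open>n - a\<close>.\<close>
    have lose: "W_cash A n d e = PlayerII"
      if rich: "f_II A n \<le> e" and bad: "W A n = PlayerII \<or> d < f_I A n"
    proof -
      have "W_cash A (n - a) e (d - a) = PlayerI" if a: "a \<in> A" "a \<le> n" "a \<le> d" for a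
      proof -
        have takes: "a \<in> takes A n"
          using a pos by (simp add: takes_eq)
        have "f_I A (n - a) \<le> e"
          using f_I_le_f_II[OF takes n] rich by linarith
        moreover have "d - a < f_II A (n - a)" if "W A (n - a) = PlayerII"
        proof -
          have "W A n = PlayerI"
            using W_rec[OF pos, of n] a that by blast
          then show ?thesis
            using f_I_le_winning[OF _ takes that n] bad a(3) by auto
        qed
        ultimately show ?thesis
          using IH(2,3)[OF takes, of "d - a"] II by (metis not_less)
      qed
      then show ?thesis
        using rec[of d e] by (auto simp: II)
    qed
    show ?thesis
      using win exhaust lose II[of "W A n"] by (metis not_less)
  qed
qed

end
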